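(* (1) Let $\mathfrak{g}$ be a Lie algebra over $\mathbb{F}$ and let $\kappa,\lambda:\mathfrak{g}\to\mathfrak{g}$ be $\mathbb{F}$-linear maps such that, for all $a,b\in\mathfrak{g}$, $$\lambda([a,b]) = [\lambda(a),b]-[a,\kappa(b)]+[a,\lambda(b)].$$ Then, for all $s\in\mathfrak{g}$, $\mathfrak{g}$ is a Lie affgebra with the affine space structure $\langle a,b,c\rangle = a-b+c$, $\alpha\triangleright_a b=\alpha b+(1-\alpha)a$ (for all $a,b,c\in\mathfrak{g}$, $\alpha\in\mathbb{F}$) and the affine Lie bracket $$\{a,b\}=[a,b]+\kappa(a)+\lambda(b-a)+s,\qquad a,b\in\mathfrak{g}.$$ Denote this Lie affgebra by $\mathfrak{a}(\mathfrak{g};\kappa,\lambda,s)$. Furthermore, for all $o\in\mathfrak{g}$, $T_o\mathfrak{a}(\mathfrak{g};\kappa,\lambda,s)\cong\mathfrak{g}$ as Lie algebras. (2) Conversely, for any Lie affgebra $\mathfrak{a}$ over $\mathbb{F}$ and any $o\in\mathfrak{a}$, there exist linear endomorphisms $\kappa,\lambda$ of the tangent Lie algebra $T_o\mathfrak{a}$ and an element $s\in T_o\mathfrak{a}$, with $\kappa,\lambda$ necessarily satisfying the identity displayed in (1) (with $\mathfrak g=T_o\mathfrak a$), such that $\mathfrak{a}=\mathfrak{a}(T_o\mathfrak{a};\kappa,\lambda,s)$.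
   Context: $\mathbb{F}$ is a field of characteristic different from 2. Abelian heap: a set $X$ with a ternary operation $\langle-,-,-\rangle$ satisfying $\langle x_1,x_2,x_3\rangle=\langle x_3,x_2,x_1\rangle$, $\langle x_1,x_1,x_2\rangle=x_2$, $\langle\langle x_1,x_2,x_3\rangle,x_4,x_5\rangle=\langle x_1,x_2,\langle x_3,x_4,x_5\rangle\rangle$ (the latter element is written $\langle x_1,\dots,x_5\rangle$). Heap homomorphisms preserve the ternary operation. Affine space over $\mathbb{F}$: a non-empty set $\mathfrak{a}$ with an abelian heap operation $\langle-,-,-\rangle$ and an operation $\mathbb{F}\times\mathfrak{a}\times\mathfrak{a}\to\mathfrak{a}$, $(\alpha,a,b)\mapsto\alpha\triangleright_a b$, such that: $\alpha\triangleright_a-$ and $-\triangleright_a b$ are heap homomorphisms ($\mathbb{F}$ being a heap via $\alpha-\beta+\gamma$); $(\alpha\beta)\triangleright_a b=\alpha\triangleright_a(\beta\triangleright_a b)$ and $1\triangleright_a b=b$; $0\triangleright_a b=a$; $\alpha\triangleright_a b=\langle\alpha\triangleright_c b,\alpha\triangleright_c a,a\rangle$ for all $a,b,c$. An affine map is a heap homomorphism $f$ with $f(\alpha\triangleright_a b)=\alpha\triangleright_{f(a)}f(b)$. Tangent space: for $o\in\mathfrak{a}$, $T_o\mathfrak{a}$ is the set $\mathfrak{a}$ with the vector space structure $a+b=\langle a,o,b\rangle$, zero $o$, and $\alpha a=\alpha\triangleright_o a$. Lie affgebra: an affine space $\mathfrak{a}$ with a binary operation $\{-,-\}:\mathfrak{a}\times\mathfrak{a}\to\mathfrak{a}$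 (the affine Lie bracket) such that (a) $\{a,-\}$ and $\{-,a\}$ are affine maps for all $a$; (b) $\langle\{a,b\},\{a,a\},\{b,a\}\rangle=\{b,b\}$ for all $a,b$; (c) $\langle\{a,\{b,c\}\},\{a,\{a,a\}\},\{b,\{c,a\}\},\{b,\{b,b\}\},\{c,\{a,b\}\}\rangle=\{c,\{c,c\}\}$ for all $a,b,c$. Tangent Lie algebra: for a Lie affgebra $\mathfrak{a}$ and $o\in\mathfrak{a}$, $T_o\mathfrak{a}$ is a Lie algebra (a known fact) with bracket $[a,b]=\{a,b\}-\{a,o\}+\{o,o\}-\{o,b\}$ (operations of the vector space $T_o\mathfrak{a}$). *)

theory Defs
  imports "HOL-Algebra.Module"
begin

section \<open>Lie algebras over a field\<close>

text \<open>Vector spaces over \<open>F\<close> are modules over the field \<open>F\<close>. The fields \<open>mult\<close> and \<open>one\<close>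
  that the record type \<^typ>\<open>('f, 'a) module\<close> inherits from rings play no role;
  the Lie bracket is a separate field.\<close>

record ('f, 'a) lie_alg = "('f, 'a) module" +
  lbr :: "'a \<Rightarrow> 'a \<Rightarrow> 'a"

definition lin_maps ::
  "('f, 'm) ring_scheme \<Rightarrow> ('f, 'a, 'n) module_scheme \<Rightarrow> ('f, 'b, 'k) module_scheme \<Rightarrow> ('a \<Rightarrow> 'b) set"
  where "lin_maps F V W = {f \<in> carrier V \<rightarrow> carrier W.
     (\<forall>x\<in>carrier V. \<forall>y\<in>carrier V. f (x \<oplus>\<^bsub>V\<^esub> y) = f x \<oplus>\<^bsub>W\<^esub> f y) \<and>
     (\<forall>\<alpha>\<in>carrier F. \<forall>x\<in>carrier V. f (\<alpha> \<odot>\<^bsub>V\<^esub> x) = \<alpha> \<odot>\<^bsub>W\<^esub> f x)}"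

locale lie_algebra = F?: field F + g?: module F g
  for F (structure) and g :: "('f, 'a, 'n) lie_alg_scheme" (structure) +
  assumes lbr_linear_right: "a \<in> carrier g \<Longrightarrow> lbr g a \<in> lin_maps F g g"
    and lbr_linear_left: "b \<in> carrier g \<Longrightarrow> (\<lambda>a. lbr g a b) \<in> lin_maps F g g"
    and lbr_alternating: "a \<in> carrier g \<Longrightarrow> lbr g a a = \<zero>\<^bsub>g\<^esub>"
    and jacobi: "\<lbrakk>a \<in> carrier g; b \<in> carrier g; c \<in> carrier g\<rbrakk> \<Longrightarrow>
      lbr g a (lbr g b c) \<oplus>\<^bsub>g\<^esub> lbr g b (lbr g c a) \<oplus>\<^bsub>g\<^esub> lbr g c (lbr g a b) = \<zero>\<^bsub>g\<^esub>"

definition lie_algebra_isos ::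
  "('f, 'm) ring_scheme \<Rightarrow> ('f, 'a, 'n) lie_alg_scheme \<Rightarrow> ('f, 'b, 'k) lie_alg_scheme \<Rightarrow> ('a \<Rightarrow> 'b) set"
  where "lie_algebra_isos F g h = {f \<in> lin_maps F g h. bij_betw f (carrier g) (carrier h) \<and>
     (\<forall>x\<in>carrier g. \<forall>y\<in>carrier g. f (lbr g x y) = lbr h (f x) (f y))}"

definition lie_algebra_isomorphic ::
  "('f, 'm) ring_scheme \<Rightarrow> ('f, 'a, 'n) lie_alg_scheme \<Rightarrow> ('f, 'b, 'k) lie_alg_scheme \<Rightarrow> bool"
  where "lie_algebra_isomorphic F g h \<longleftrightarrow>
     lie_algebra F g \<and> lie_algebra F h \<and> lie_algebra_isos F g h \<noteq> {}"

section \<open>Abelian heaps\<close>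

record 'a heap = "'a partial_object" +
  tern :: "'a \<Rightarrow> 'a \<Rightarrow> 'a \<Rightarrow> 'a"  (\<open>\<langle>_,/ _,/ _\<rangle>\<index>\<close>)

locale abelian_heap =
  fixes X :: "('a, 'n) heap_scheme" (structure)
  assumes tern_closed: "\<lbrakk>x1 \<in> carrier X; x2 \<in> carrier X; x3 \<in> carrier X\<rbrakk> \<Longrightarrow>
      \<langle>x1, x2, x3\<rangle> \<in> carrier X"
    and tern_comm: "\<lbrakk>x1 \<in> carrier X; x2 \<in> carrier X; x3 \<in> carrier X\<rbrakk> \<Longrightarrow>
      \<langle>x1, x2, x3\<rangle> = \<langle>x3, x2, x1\<rangle>"
    and tern_cancel: "\<lbrakk>x1 \<in> carrier X; x2 \<in> carrier X\<rbrakk> \<Longrightarrow> \<langle>x1, x1, x2\<rangle> = x2"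
    and tern_assoc: "\<lbrakk>x1 \<in> carrier X; x2 \<in> carrier X; x3 \<in> carrier X; x4 \<in> carrier X; x5 \<in> carrier X\<rbrakk> \<Longrightarrow>
      \<langle>\<langle>x1, x2, x3\<rangle>, x4, x5\<rangle> = \<langle>x1, x2, \<langle>x3, x4, x5\<rangle>\<rangle>"

definition tern5 :: "('a, 'n) heap_scheme \<Rightarrow> 'a \<Rightarrow> 'a \<Rightarrow> 'a \<Rightarrow> 'a \<Rightarrow> 'a \<Rightarrow> 'a"
  where "tern5 X x1 x2 x3 x4 x5 = \<langle>\<langle>x1, x2, x3\<rangle>\<^bsub>X\<^esub>, x4, x5\<rangle>\<^bsub>X\<^esub>"

definition heap_homs :: "('a, 'n) heap_scheme \<Rightarrow> ('b, 'k) heap_scheme \<Rightarrow> ('a \<Rightarrow> 'b) set"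
  where "heap_homs X Y = {f \<in> carrier X \<rightarrow> carrier Y.
     \<forall>x\<in>carrier X. \<forall>y\<in>carrier X. \<forall>z\<in>carrier X. f \<langle>x, y, z\<rangle>\<^bsub>X\<^esub> = \<langle>f x, f y, f z\<rangle>\<^bsub>Y\<^esub>}"

definition ring_heap :: "('f, 'm) ring_scheme \<Rightarrow> 'f heap"
  where "ring_heap F = \<lparr>carrier = carrier F, tern = (\<lambda>\<alpha> \<beta> \<gamma>. \<alpha> \<ominus>\<^bsub>F\<^esub> \<beta> \<oplus>\<^bsub>F\<^esub> \<gamma>)\<rparr>"

section \<open>Affine spaces\<close>

text \<open>\<open>act A \<alpha> a b\<close> is \<open>\<alpha> \<triangleright>\<^sub>a b\<close>, with the base point \<open>a\<close> before \<open>b\<close>.\<close>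

record ('f, 'a) aff = "'a heap" +
  act :: "'f \<Rightarrow> 'a \<Rightarrow> 'a \<Rightarrow> 'a"

locale affine_space = F?: field F + A?: abelian_heap A
  for F (structure) and A :: "('f, 'a, 'n) aff_scheme" (structure) +
  assumes nonempty: "carrier A \<noteq> {}"
    and act_hom_right: "\<lbrakk>\<alpha> \<in> carrier F; a \<in> carrier A\<rbrakk> \<Longrightarrow>
      (\<lambda>b. act A \<alpha> a b) \<in> heap_homs A A"
    and act_hom_scalar: "\<lbrakk>a \<in> carrier A; b \<in> carrier A\<rbrakk> \<Longrightarrow>
      (\<lambda>\<alpha>. act A \<alpha> a b) \<in> heap_homs (ring_heap F) A"
    and act_mult: "\<lbrakk>\<alpha> \<in> carrier F; \<beta> \<in> carrier F; a \<in> carrier A; b \<in> carrier A\<rbrakk> \<Longrightarrow>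
      act A (\<alpha> \<otimes> \<beta>) a b = act A \<alpha> a (act A \<beta> a b)"
    and act_one: "\<lbrakk>a \<in> carrier A; b \<in> carrier A\<rbrakk> \<Longrightarrow> act A \<one> a b = b"
    and act_zero: "\<lbrakk>a \<in> carrier A; b \<in> carrier A\<rbrakk> \<Longrightarrow> act A \<zero> a b = a"
    and act_base_change: "\<lbrakk>\<alpha> \<in> carrier F; a \<in> carrier A; b \<in> carrier A; c \<in> carrier A\<rbrakk> \<Longrightarrow>
      act A \<alpha> a b = \<langle>act A \<alpha> c b, act A \<alpha> c a, a\<rangle>\<^bsub>A\<^esub>"

definition affine_maps ::
  "('f, 'm) ring_scheme \<Rightarrow> ('f, 'a, 'n) aff_scheme \<Rightarrow> ('f, 'b, 'k) aff_scheme \<Rightarrow> ('a \<Rightarrow> 'b) set"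
  where "affine_maps F A B = {f \<in> heap_homs A B.
     \<forall>\<alpha>\<in>carrier F. \<forall>a\<in>carrier A. \<forall>b\<in>carrier A. f (act A \<alpha> a b) = act B \<alpha> (f a) (f b)}"

definition tangent_space :: "('f, 'a, 'n) aff_scheme \<Rightarrow> 'a \<Rightarrow> ('f, 'a) module"
  where "tangent_space A p =
    \<lparr>carrier = carrier A, mult = undefined, one = undefined,
     zero = p, add = (\<lambda>a b. \<langle>a, p, b\<rangle>\<^bsub>A\<^esub>), smult = (\<lambda>\<alpha> a. act A \<alpha> p a)\<rparr>"

section \<open>Lie affgebras\<close>

record ('f, 'a) lie_aff = "('f, 'a) aff" +
  abr :: "'a \<Rightarrow> 'a \<Rightarrow> 'a"  (\<open>\<lbrace>_,/ _\<rbrace>\<index>\<close>)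

locale lie_affgebra = affine_space F A
  for F (structure) and A :: "('f, 'a, 'n) lie_aff_scheme" (structure) +
  assumes abr_affine_right: "a \<in> carrier A \<Longrightarrow> (\<lambda>b. \<lbrace>a, b\<rbrace>\<^bsub>A\<^esub>) \<in> affine_maps F A A"
    and abr_affine_left: "a \<in> carrier A \<Longrightarrow> (\<lambda>b. \<lbrace>b, a\<rbrace>\<^bsub>A\<^esub>) \<in> affine_maps F A A"
    and abr_antisym: "\<lbrakk>a \<in> carrier A; b \<in> carrier A\<rbrakk> \<Longrightarrow>
      \<langle>\<lbrace>a, b\<rbrace>\<^bsub>A\<^esub>, \<lbrace>a, a\<rbrace>\<^bsub>A\<^esub>, \<lbrace>b, a\<rbrace>\<^bsub>A\<^esub>\<rangle>\<^bsub>A\<^esub> = \<lbrace>b, b\<rbrace>\<^bsub>A\<^esub>"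
    and abr_jacobi: "\<lbrakk>a \<in> carrier A; b \<in> carrier A; c \<in> carrier A\<rbrakk> \<Longrightarrow>
      tern5 A \<lbrace>a, \<lbrace>b, c\<rbrace>\<^bsub>A\<^esub>\<rbrace>\<^bsub>A\<^esub> \<lbrace>a, \<lbrace>a, a\<rbrace>\<^bsub>A\<^esub>\<rbrace>\<^bsub>A\<^esub>
        \<lbrace>b, \<lbrace>c, a\<rbrace>\<^bsub>A\<^esub>\<rbrace>\<^bsub>A\<^esub> \<lbrace>b, \<lbrace>b, b\<rbrace>\<^bsub>A\<^esub>\<rbrace>\<^bsub>A\<^esub> \<lbrace>c, \<lbrace>a, b\<rbrace>\<^bsub>A\<^esub>\<rbrace>\<^bsub>A\<^esub>
      = \<lbrace>c, \<lbrace>c, c\<rbrace>\<^bsub>A\<^esub>\<rbrace>\<^bsub>A\<^esub>"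

text \<open>Equality of affine spaces with a binary operation as structures over \<open>F\<close>: same underlying
  set and same operations there. Record equality would also compare the irrelevant values of the
  operations off the carriers.\<close>

definition lie_aff_eq ::
  "('f, 'm) ring_scheme \<Rightarrow> ('f, 'a, 'n) lie_aff_scheme \<Rightarrow> ('f, 'a, 'k) lie_aff_scheme \<Rightarrow> bool"
  where "lie_aff_eq F A B \<longleftrightarrow>
     carrier A = carrier B \<and>
     (\<forall>a\<in>carrier A. \<forall>b\<in>carrier A. \<forall>c\<in>carrier A. \<langle>a, b, c\<rangle>\<^bsub>A\<^esub> = \<langle>a, b, c\<rangle>\<^bsub>B\<^esub>) \<and>
     (\<forall>\<alpha>\<in>carrier F. \<forall>a\<in>carrier A. \<forall>b\<in>carrier A. act A \<alpha> a b = act B \<alpha> a b) \<and>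
     (\<forall>a\<in>carrier A. \<forall>b\<in>carrier A. \<lbrace>a, b\<rbrace>\<^bsub>A\<^esub> = \<lbrace>a, b\<rbrace>\<^bsub>B\<^esub>)"

text \<open>In \<open>lbr\<close> below, all vector space operations are those of the tangent space at \<open>p\<close>.\<close>

definition tangent_lie :: "('f, 'a, 'n) lie_aff_scheme \<Rightarrow> 'a \<Rightarrow> ('f, 'a) lie_alg"
  where "tangent_lie A p = (let T = tangent_space A p in
    module.extend T
      \<lparr>lbr = (\<lambda>a b. \<lbrace>a, b\<rbrace>\<^bsub>A\<^esub> \<ominus>\<^bsub>T\<^esub> \<lbrace>a, p\<rbrace>\<^bsub>A\<^esub> \<oplus>\<^bsub>T\<^esub> \<lbrace>p, p\<rbrace>\<^bsub>A\<^esub> \<ominus>\<^bsub>T\<^esub> \<lbrace>p, b\<rbrace>\<^bsub>A\<^esub>)\<rparr>)"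

definition compatible_pair ::
  "('f, 'a, 'n) lie_alg_scheme \<Rightarrow> ('a \<Rightarrow> 'a) \<Rightarrow> ('a \<Rightarrow> 'a) \<Rightarrow> bool"
  where "compatible_pair g \<kappa> \<Lambda> \<longleftrightarrow> (\<forall>a\<in>carrier g. \<forall>b\<in>carrier g.
     \<Lambda> (lbr g a b) = lbr g (\<Lambda> a) b \<ominus>\<^bsub>g\<^esub> lbr g a (\<kappa> b) \<oplus>\<^bsub>g\<^esub> lbr g a (\<Lambda> b))"

text \<open>The structure \<open>\<aa>(g; \<kappa>, \<lambda>, s)\<close>, written down for arbitrary maps; the symbol \<open>\<Lambda>\<close> stands
  for \<open>\<lambda>\<close>, which is reserved syntax.\<close>

definition affgebra_of ::
  "('f, 'm) ring_scheme \<Rightarrow> ('f, 'a, 'n) lie_alg_scheme \<Rightarrow> ('a \<Rightarrow> 'a) \<Rightarrow> ('a \<Rightarrow> 'a) \<Rightarrow> 'a \<Rightarrow> ('f, 'a) lie_aff"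
  where "affgebra_of F g \<kappa> \<Lambda> s =
    \<lparr>carrier = carrier g,
     tern = (\<lambda>a b c. a \<ominus>\<^bsub>g\<^esub> b \<oplus>\<^bsub>g\<^esub> c),
     act = (\<lambda>\<alpha> a b. \<alpha> \<odot>\<^bsub>g\<^esub> b \<oplus>\<^bsub>g\<^esub> (\<one>\<^bsub>F\<^esub> \<ominus>\<^bsub>F\<^esub> \<alpha>) \<odot>\<^bsub>g\<^esub> a),
     abr = (\<lambda>a b. lbr g a b \<oplus>\<^bsub>g\<^esub> \<kappa> a \<oplus>\<^bsub>g\<^esub> \<Lambda> (b \<ominus>\<^bsub>g\<^esub> a) \<oplus>\<^bsub>g\<^esub> s)\<rparr>"

end

theory Submission
  imports Defs
begin

text \<open>Fixing a point \<open>p\<close> of an affine space turns it into a vector space in which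
  \<open>\<langle>a, b, c\<rangle> = a - b + c\<close> and \<open>\<alpha> \<triangleright>\<^sub>a b = \<alpha> b + (1 - \<alpha>) a\<close> (\<open>tern_tangent\<close>, \<open>act_tangent\<close>), and an
  affine map turns into a linear map plus a constant (\<open>affine_map_linear_part\<close>). A biaffine bracket
  is therefore a bilinear map \<open>[a, b]\<close> plus a linear map in each variable plus a constant. Writing
  the two linear maps as \<open>\<kappa> - \<Lambda>\<close> and \<open>\<Lambda>\<close> gives exactly the shape
  \<open>[a, b] + \<kappa> a + \<Lambda> (b - a) + s\<close>, and \<open>[a, b]\<close> is the bracket of the tangent Lie algebra
  (\<open>tangent_data\<close>).

  So both parts of the theorem ask one question about a bracket of this shape with \<open>[a, b]\<close> merely
  bilinear: when does it satisfy the two identities of a Lie affgebra? Affine antisymmetry holds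
  exactly if \<open>[a, b]\<close> is alternating (\<open>antisym_iff_alternating\<close>). Given that, the two sides of the
  affine Jacobi identity differ by
  \<open>J a b c + C a b + C b c + C c a - C a a - C b b - C c c\<close>,
  where \<open>J\<close> is the Jacobi sum of \<open>[a, b]\<close> and \<open>C\<close> is the failure of the compatibility condition
  between \<open>\<kappa>\<close> and \<open>\<Lambda>\<close> (\<open>jacobi_expansion\<close>). As \<open>C\<close> is bilinear, setting two arguments to zero
  leaves a diagonal value of \<open>C\<close>, setting one to zero then leaves \<open>C a b\<close>, and what remains is \<open>J\<close>.
  Hence the affine Jacobi identity is the Jacobi identity together with compatibility
  (\<open>lie_affgebra_iff\<close>). Read in one direction this makes \<open>\<aa>(g; \<kappa>, \<Lambda>, s)\<close> a Lie affgebra; read in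
  the other it shows that tangent spaces are Lie algebras and that any \<open>\<kappa>\<close>, \<open>\<Lambda>\<close> which represent a
  Lie affgebra are compatible.

  The tangent Lie algebra of \<open>\<aa>(g; \<kappa>, \<Lambda>, s)\<close> at \<open>p\<close> is carried to \<open>g\<close> by the translation
  \<open>x \<mapsto> x - p\<close> (\<open>tangent_iso\<close>).\<close>

section \<open>Sums and differences in abelian groups\<close>

text \<open>With commutativity and associativity these rules decide identities between sums and differences:
  every expression becomes a difference of two sums, subtracted terms move to the other side of
  the equation, and both sides are then sums of the same terms up to order.\<close>

lemma (in abelian_group) diff_simps:
  assumes "x \<in> carrier G" "y \<in> carrier G"
  shows "x \<oplus> \<ominus> y = x \<ominus> y"
    and "\<ominus> x \<oplus> y = y \<ominus> x"
    and "x \<ominus> \<ominus> y = x \<oplus> y"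
    and "\<ominus> x \<ominus> y = \<ominus> (x \<oplus> y)"
    and "\<ominus> (x \<ominus> y) = y \<ominus> x"
    and "\<ominus> x = y \<longleftrightarrow> \<zero> = x \<oplus> y"
    and "x = \<ominus> y \<longleftrightarrow> x \<oplus> y = \<zero>"
    and "x \<ominus> \<zero> = x"
    and "\<zero> \<ominus> x = \<ominus> x"
    and "z \<in> carrier G \<Longrightarrow> (x \<ominus> y) \<oplus> z = (x \<oplus> z) \<ominus> y"
    and "z \<in> carrier G \<Longrightarrow> x \<oplus> (y \<ominus> z) = (x \<oplus> y) \<ominus> z"
    and "z \<in> carrier G \<Longrightarrow> (x \<ominus> y) \<ominus> z = x \<ominus> (y \<oplus> z)"
    and "z \<in> carrier G \<Longrightarrow> x \<ominus> (y \<ominus> z) = (x \<oplus> z) \<ominus> y"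
    and "z \<in> carrier G \<Longrightarrow> x \<ominus> y = z \<longleftrightarrow> x = z \<oplus> y"
    and "z \<in> carrier G \<Longrightarrow> x = y \<ominus> z \<longleftrightarrow> x \<oplus> z = y"
proof -
  have minus_eq: "u \<ominus> v = w \<longleftrightarrow> u = w \<oplus> v"
    if "u \<in> carrier G" "v \<in> carrier G" "w \<in> carrier G" for u v w
    using that by (metis a_assoc a_minus_def add.inv_closed l_neg r_neg r_zero)
  show "x \<oplus> \<ominus> y = x \<ominus> y" "\<ominus> x \<oplus> y = y \<ominus> x" "x \<ominus> \<ominus> y = x \<oplus> y"
    "\<ominus> x \<ominus> y = \<ominus> (x \<oplus> y)" "\<ominus> (x \<ominus> y) = y \<ominus> x" "x \<ominus> \<zero> = x" "\<zero> \<ominus> x = \<ominus> x"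
    using assms by (simp_all add: a_minus_def minus_add a_comm)
  show "\<ominus> x = y \<longleftrightarrow> \<zero> = x \<oplus> y" "x = \<ominus> y \<longleftrightarrow> x \<oplus> y = \<zero>"
    using assms by (metis a_comm minus_equality r_neg)+
  assume z: "z \<in> carrier G"
  show "(x \<ominus> y) \<oplus> z = (x \<oplus> z) \<ominus> y" "x \<oplus> (y \<ominus> z) = (x \<oplus> y) \<ominus> z"
    "(x \<ominus> y) \<ominus> z = x \<ominus> (y \<oplus> z)" "x \<ominus> (y \<ominus> z) = (x \<oplus> z) \<ominus> y"
    using assms z by (simp_all add: a_minus_def minus_add a_ac)
  show "x \<ominus> y = z \<longleftrightarrow> x = z \<oplus> y" "x = y \<ominus> z \<longleftrightarrow> x \<oplus> z = y"
    using assms z minus_eq[of x y z] minus_eq[of y z x] by auto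
qed

lemma (in abelian_group) diff_eq_zero_iff:
  assumes "x \<in> carrier G" "y \<in> carrier G"
  shows "x \<ominus> y = \<zero> \<longleftrightarrow> x = y"
  using assms by (simp add: diff_simps)

section \<open>Linear maps\<close>

lemma lin_mapsD:
  assumes "f \<in> lin_maps F V W"
  shows "x \<in> carrier V \<Longrightarrow> f x \<in> carrier W"
    and "\<lbrakk>x \<in> carrier V; y \<in> carrier V\<rbrakk> \<Longrightarrow> f (x \<oplus>\<^bsub>V\<^esub> y) = f x \<oplus>\<^bsub>W\<^esub> f y"
    and "\<lbrakk>\<alpha> \<in> carrier F; x \<in> carrier V\<rbrakk> \<Longrightarrow> f (\<alpha> \<odot>\<^bsub>V\<^esub> x) = \<alpha> \<odot>\<^bsub>W\<^esub> f x"
  using assms by (auto simp: lin_maps_def)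

lemma lin_map_zero_minus:
  assumes "abelian_group V" "abelian_group W" "f \<in> lin_maps F V W"
  shows "f \<zero>\<^bsub>V\<^esub> = \<zero>\<^bsub>W\<^esub>"
    and "x \<in> carrier V \<Longrightarrow> f (\<ominus>\<^bsub>V\<^esub> x) = \<ominus>\<^bsub>W\<^esub> f x"
    and "\<lbrakk>x \<in> carrier V; y \<in> carrier V\<rbrakk> \<Longrightarrow> f (x \<ominus>\<^bsub>V\<^esub> y) = f x \<ominus>\<^bsub>W\<^esub> f y"
proof -
  interpret V: abelian_group V by fact
  interpret W: abelian_group W by fact
  note f = lin_mapsD[OF assms(3)]
  have "f \<zero>\<^bsub>V\<^esub> \<oplus>\<^bsub>W\<^esub> f \<zero>\<^bsub>V\<^esub> = f \<zero>\<^bsub>V\<^esub>"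
    using f(2)[of "\<zero>\<^bsub>V\<^esub>" "\<zero>\<^bsub>V\<^esub>"] by simp
  then show zero: "f \<zero>\<^bsub>V\<^esub> = \<zero>\<^bsub>W\<^esub>" using f(1) by simp
  show neg: "f (\<ominus>\<^bsub>V\<^esub> x) = \<ominus>\<^bsub>W\<^esub> f x" if "x \<in> carrier V" for x
    using f(2)[of x "\<ominus>\<^bsub>V\<^esub> x"] that zero f(1) by (simp add: V.r_neg W.diff_simps W.a_comm)
  show "f (x \<ominus>\<^bsub>V\<^esub> y) = f x \<ominus>\<^bsub>W\<^esub> f y" if "x \<in> carrier V" "y \<in> carrier V"
    using that by (simp add: a_minus_def f neg)
qed

lemma (in module) smult_diff:
  assumes "\<alpha> \<in> carrier R" "x \<in> carrier M" "y \<in> carrier M"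
  shows "\<alpha> \<odot>\<^bsub>M\<^esub> (x \<ominus>\<^bsub>M\<^esub> y) = \<alpha> \<odot>\<^bsub>M\<^esub> x \<ominus>\<^bsub>M\<^esub> \<alpha> \<odot>\<^bsub>M\<^esub> y"
  using assms by (simp add: a_minus_def smult_r_distr smult_r_minus)

lemma (in module) smult_diff_scalar:
  assumes "\<alpha> \<in> carrier R" "\<beta> \<in> carrier R" "x \<in> carrier M"
  shows "(\<alpha> \<ominus> \<beta>) \<odot>\<^bsub>M\<^esub> x = \<alpha> \<odot>\<^bsub>M\<^esub> x \<ominus>\<^bsub>M\<^esub> \<beta> \<odot>\<^bsub>M\<^esub> x"
  using assms by (simp add: a_minus_def smult_l_distr smult_l_minus)

lemma (in module) lin_maps_cong:
  assumes "u \<in> lin_maps R M W" and "\<And>x. x \<in> carrier M \<Longrightarrow> v x = u x"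
  shows "v \<in> lin_maps R M W"
  using assms by (simp add: lin_maps_def Pi_iff)

lemma (in module) lin_maps_sum_diff:
  assumes "u \<in> lin_maps R V M" "v \<in> lin_maps R V M"
  shows "(\<lambda>x. u x \<oplus>\<^bsub>M\<^esub> v x) \<in> lin_maps R V M"
    and "(\<lambda>x. u x \<ominus>\<^bsub>M\<^esub> v x) \<in> lin_maps R V M"
proof -
  note u = lin_mapsD[OF assms(1)] and v = lin_mapsD[OF assms(2)]
  show "(\<lambda>x. u x \<oplus>\<^bsub>M\<^esub> v x) \<in> lin_maps R V M" "(\<lambda>x. u x \<ominus>\<^bsub>M\<^esub> v x) \<in> lin_maps R V M"
    unfolding lin_maps_def
    using u v by (auto simp: smult_r_distr smult_diff M.diff_simps M.a_ac)
qed

section \<open>Tangent spaces\<close>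

context affine_space
begin

lemma act_closed [simp]:
  "\<lbrakk>\<alpha> \<in> carrier F; a \<in> carrier A; b \<in> carrier A\<rbrakk> \<Longrightarrow> act A \<alpha> a b \<in> carrier A"
  using act_hom_right by (auto simp: heap_homs_def)

lemma tangent_simps:
  "carrier (tangent_space A p) = carrier A"
  "\<zero>\<^bsub>tangent_space A p\<^esub> = p"
  "a \<oplus>\<^bsub>tangent_space A p\<^esub> b = \<langle>a, p, b\<rangle>\<^bsub>A\<^esub>"
  "\<alpha> \<odot>\<^bsub>tangent_space A p\<^esub> a = act A \<alpha> p a"
  by (simp_all add: tangent_space_def)

lemma act_self: "\<lbrakk>\<alpha> \<in> carrier F; a \<in> carrier A\<rbrakk> \<Longrightarrow> act A \<alpha> a a = a"
  using act_base_change[of \<alpha> a a a] by (simp add: tern_cancel)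

lemma tern_cancel_right: "\<lbrakk>a \<in> carrier A; b \<in> carrier A\<rbrakk> \<Longrightarrow> \<langle>a, b, b\<rangle>\<^bsub>A\<^esub> = a"
  using tern_comm[of a b b] tern_cancel[of b a] by simp

lemma tangent_module:
  assumes p: "p \<in> carrier A"
  shows "module F (tangent_space A p)"
proof (rule moduleI)
  show "cring F" by (rule F.is_cring)
  show "abelian_group (tangent_space A p)"
  proof (rule abelian_groupI; simp only: tangent_simps)
    show "\<langle>x, p, y\<rangle>\<^bsub>A\<^esub> \<in> carrier A" if "x \<in> carrier A" "y \<in> carrier A" for x y
      using that p by (simp add: tern_closed)
    show "p \<in> carrier A" by fact
    show "\<langle>\<langle>x, p, y\<rangle>\<^bsub>A\<^esub>, p, z\<rangle>\<^bsub>A\<^esub> = \<langle>x, p, \<langle>y, p, z\<rangle>\<^bsub>A\<^esub>\<rangle>\<^bsub>A\<^esub>"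
      if "x \<in> carrier A" "y \<in> carrier A" "z \<in> carrier A" for x y z
      using that p by (simp add: tern_assoc)
    show "\<langle>x, p, y\<rangle>\<^bsub>A\<^esub> = \<langle>y, p, x\<rangle>\<^bsub>A\<^esub>" if "x \<in> carrier A" "y \<in> carrier A" for x y
      using that p by (simp add: tern_comm)
    show "\<langle>p, p, x\<rangle>\<^bsub>A\<^esub> = x" if "x \<in> carrier A" for x
      using that p by (simp add: tern_cancel)
    show "\<exists>y\<in>carrier A. \<langle>y, p, x\<rangle>\<^bsub>A\<^esub> = p" if "x \<in> carrier A" for x
      using that p
      by (intro bexI[of _ "\<langle>p, x, p\<rangle>\<^bsub>A\<^esub>"])
        (simp_all add: tern_assoc tern_cancel tern_cancel_right tern_closed)
  qed
  fix \<alpha> \<beta> x y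
  assume \<alpha>: "\<alpha> \<in> carrier F" and "x \<in> carrier (tangent_space A p)"
  then have x: "x \<in> carrier A" by (simp add: tangent_simps)
  show "\<alpha> \<odot>\<^bsub>tangent_space A p\<^esub> x \<in> carrier (tangent_space A p)"
    using \<alpha> x p by (simp add: tangent_simps)
  show "\<alpha> \<odot>\<^bsub>tangent_space A p\<^esub> (x \<oplus>\<^bsub>tangent_space A p\<^esub> y)
      = \<alpha> \<odot>\<^bsub>tangent_space A p\<^esub> x \<oplus>\<^bsub>tangent_space A p\<^esub> \<alpha> \<odot>\<^bsub>tangent_space A p\<^esub> y"
    if "y \<in> carrier (tangent_space A p)"
    using that act_hom_right[OF \<alpha> p] p x \<alpha> by (simp add: tangent_simps heap_homs_def act_self)
  assume \<beta>: "\<beta> \<in> carrier F"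
  have "act A (\<alpha> \<ominus> \<zero> \<oplus> \<beta>) p x = \<langle>act A \<alpha> p x, act A \<zero> p x, act A \<beta> p x\<rangle>\<^bsub>A\<^esub>"
    using act_hom_scalar[OF p x] \<alpha> \<beta> by (simp add: heap_homs_def ring_heap_def)
  then show "(\<alpha> \<oplus> \<beta>) \<odot>\<^bsub>tangent_space A p\<^esub> x
      = \<alpha> \<odot>\<^bsub>tangent_space A p\<^esub> x \<oplus>\<^bsub>tangent_space A p\<^esub> \<beta> \<odot>\<^bsub>tangent_space A p\<^esub> x"
    using \<alpha> \<beta> p x by (simp add: tangent_simps act_zero F.diff_simps)
  show "(\<alpha> \<otimes> \<beta>) \<odot>\<^bsub>tangent_space A p\<^esub> x
      = \<alpha> \<odot>\<^bsub>tangent_space A p\<^esub> (\<beta> \<odot>\<^bsub>tangent_space A p\<^esub> x)"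
    using \<alpha> \<beta> p x by (simp add: tangent_simps act_mult)
next
  show "\<one> \<odot>\<^bsub>tangent_space A p\<^esub> x = x" if "x \<in> carrier (tangent_space A p)" for x
    using that p by (simp add: tangent_simps act_one)
qed

text \<open>The vector space difference \<open>a - b\<close> is the point \<open>x\<close> with \<open>\<langle>x, p, b\<rangle> = a\<close>.\<close>

lemma tangent_diff:
  assumes "p \<in> carrier A" "a \<in> carrier A" "b \<in> carrier A"
  shows "a \<ominus>\<^bsub>tangent_space A p\<^esub> b = \<langle>a, b, p\<rangle>\<^bsub>A\<^esub>"
proof -
  interpret T: module F "tangent_space A p" using assms(1) by (rule tangent_module)
  have "\<langle>\<langle>a, b, p\<rangle>\<^bsub>A\<^esub>, p, b\<rangle>\<^bsub>A\<^esub> = a"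
    using assms by (simp add: tern_assoc tern_cancel tern_cancel_right)
  then show ?thesis
    using assms tern_closed
    by (subst T.diff_simps(14)) (simp_all add: tangent_simps)
qed

lemma tern_tangent:
  assumes "p \<in> carrier A" "a \<in> carrier A" "b \<in> carrier A" "c \<in> carrier A"
  shows "\<langle>a, b, c\<rangle>\<^bsub>A\<^esub> = a \<ominus>\<^bsub>tangent_space A p\<^esub> b \<oplus>\<^bsub>tangent_space A p\<^esub> c"
  using assms by (simp add: tangent_diff tangent_simps tern_assoc tern_cancel tern_closed)

text \<open>Moving the base point to \<open>p\<close> gives \<open>\<alpha> \<triangleright>\<^sub>a b = \<langle>\<alpha> b, \<alpha> a, a\<rangle>\<close>, with multiples taken at \<open>p\<close>.\<close>

lemma act_tangent:
  assumes "p \<in> carrier A" "\<alpha> \<in> carrier F" "a \<in> carrier A" "b \<in> carrier A"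
  shows "act A \<alpha> a b = \<alpha> \<odot>\<^bsub>tangent_space A p\<^esub> b
    \<oplus>\<^bsub>tangent_space A p\<^esub> (\<one> \<ominus> \<alpha>) \<odot>\<^bsub>tangent_space A p\<^esub> a"
proof -
  interpret T: module F "tangent_space A p" using assms(1) by (rule tangent_module)
  let ?T = "tangent_space A p"
  note carrier_eq = tangent_simps(1)[of p, symmetric]
  have act: "act A \<alpha> a b = \<alpha> \<odot>\<^bsub>?T\<^esub> b \<ominus>\<^bsub>?T\<^esub> \<alpha> \<odot>\<^bsub>?T\<^esub> a \<oplus>\<^bsub>?T\<^esub> a"
    using act_base_change[of \<alpha> a b p] assms
    by (simp add: tern_tangent[OF assms(1)]) (simp add: tangent_simps)
  have smult: "(\<one> \<ominus> \<alpha>) \<odot>\<^bsub>?T\<^esub> a = a \<ominus>\<^bsub>?T\<^esub> \<alpha> \<odot>\<^bsub>?T\<^esub> a"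
    using assms unfolding carrier_eq by (simp add: T.smult_diff_scalar)
  show ?thesis
    unfolding act smult using assms unfolding carrier_eq by (simp add: T.M.diff_simps T.M.a_ac)
qed

text \<open>As \<open>p\<close> is the zero vector, \<open>x + y\<close> is \<open>\<langle>x, p, y\<rangle>\<close> and \<open>\<alpha> x\<close> is \<open>\<alpha> \<triangleright>\<^sub>p x\<close>; an affine map \<open>f\<close>
  preserves both operations up to replacing \<open>p\<close> by \<open>f p\<close>, and subtracting \<open>f p\<close> repairs this.\<close>

lemma affine_map_linear_part:
  assumes p: "p \<in> carrier A" and f: "f \<in> affine_maps F A A"
  shows "(\<lambda>x. f x \<ominus>\<^bsub>tangent_space A p\<^esub> f p)
    \<in> lin_maps F (tangent_space A p) (tangent_space A p)"
proof -
  interpret T: module F "tangent_space A p" using p by (rule tangent_module)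
  let ?T = "tangent_space A p"
  note carrier_eq = tangent_simps(1)[of p, symmetric]
  have closed: "f x \<in> carrier A" if "x \<in> carrier A" for x
    using f that by (auto simp: affine_maps_def heap_homs_def)
  have add: "f (x \<oplus>\<^bsub>?T\<^esub> y) = f x \<ominus>\<^bsub>?T\<^esub> f p \<oplus>\<^bsub>?T\<^esub> f y"
    if "x \<in> carrier A" "y \<in> carrier A" for x y
    using f that p closed
    by (simp add: affine_maps_def heap_homs_def tern_tangent[OF p, symmetric])
      (simp add: tangent_simps)
  have smult: "f (\<alpha> \<odot>\<^bsub>?T\<^esub> x) = \<alpha> \<odot>\<^bsub>?T\<^esub> f x \<oplus>\<^bsub>?T\<^esub> (\<one> \<ominus> \<alpha>) \<odot>\<^bsub>?T\<^esub> f p"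
    if "\<alpha> \<in> carrier F" "x \<in> carrier A" for \<alpha> x
    using f that p closed
    by (simp add: affine_maps_def act_tangent[OF p, symmetric]) (simp add: tangent_simps)
  show ?thesis
    unfolding lin_maps_def
    using p closed add smult unfolding carrier_eq
    by (auto simp: T.smult_diff_scalar T.smult_diff T.M.diff_simps T.M.a_ac)
qed

end

section \<open>Affine brackets built from a bilinear bracket\<close>

text \<open>The bracket \<open>lbr g\<close> is only assumed to be bilinear, so that its being alternating and the Jacobi
  identity can be conclusions as well as hypotheses. This is what lets both directions of the
  correspondence be read off a single equivalence.\<close>

locale affgebra_data = F?: field F + g?: module F g
  for F (structure) and g :: "('f, 'a, 'n) lie_alg_scheme" (structure) +
  fixes \<kappa> \<Lambda> :: "'a \<Rightarrow> 'a" and s :: 'a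
  assumes bracket_linear_right: "a \<in> carrier g \<Longrightarrow> lbr g a \<in> lin_maps F g g"
    and bracket_linear_left: "b \<in> carrier g \<Longrightarrow> (\<lambda>a. lbr g a b) \<in> lin_maps F g g"
    and kappa_linear: "\<kappa> \<in> lin_maps F g g"
    and Lambda_linear: "\<Lambda> \<in> lin_maps F g g"
    and s_closed [simp]: "s \<in> carrier g"
begin

abbreviation B where "B \<equiv> affgebra_of F g \<kappa> \<Lambda> s"

lemmas bracket_right =
  lin_mapsD[OF bracket_linear_right]
  lin_map_zero_minus[OF g.M.abelian_group_axioms g.M.abelian_group_axioms bracket_linear_right]

lemmas bracket_left =
  lin_mapsD[OF bracket_linear_left]
  lin_map_zero_minus[OF g.M.abelian_group_axioms g.M.abelian_group_axioms bracket_linear_left]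

lemmas kappa_simps [simp] =
  lin_mapsD[OF kappa_linear]
  lin_map_zero_minus[OF g.M.abelian_group_axioms g.M.abelian_group_axioms kappa_linear]

lemmas Lambda_simps [simp] =
  lin_mapsD[OF Lambda_linear]
  lin_map_zero_minus[OF g.M.abelian_group_axioms g.M.abelian_group_axioms Lambda_linear]

declare bracket_right [simp] bracket_left(2-) [simp]

lemma B_simps [simp]:
  "carrier B = carrier g"
  "\<langle>a, b, c\<rangle>\<^bsub>B\<^esub> = a \<ominus>\<^bsub>g\<^esub> b \<oplus>\<^bsub>g\<^esub> c"
  "act B \<alpha> a b = \<alpha> \<odot>\<^bsub>g\<^esub> b \<oplus>\<^bsub>g\<^esub> (\<one> \<ominus> \<alpha>) \<odot>\<^bsub>g\<^esub> a"
  by (simp_all add: affgebra_of_def)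

lemma B_bracket:
  "\<lbrakk>a \<in> carrier g; b \<in> carrier g\<rbrakk> \<Longrightarrow>
    \<lbrace>a, b\<rbrace>\<^bsub>B\<^esub> = lbr g a b \<oplus>\<^bsub>g\<^esub> \<kappa> a \<oplus>\<^bsub>g\<^esub> (\<Lambda> b \<ominus>\<^bsub>g\<^esub> \<Lambda> a) \<oplus>\<^bsub>g\<^esub> s"
  by (simp add: affgebra_of_def)

lemma B_bracket_closed: "\<lbrakk>a \<in> carrier g; b \<in> carrier g\<rbrakk> \<Longrightarrow> \<lbrace>a, b\<rbrace>\<^bsub>B\<^esub> \<in> carrier g"
  by (simp add: B_bracket)

lemma affine_space_B: "affine_space F B"
proof
  show "carrier B \<noteq> {}" using s_closed by auto
  show "act B (\<alpha> \<otimes> \<beta>) a b = act B \<alpha> a (act B \<beta> a b)"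
    if "\<alpha> \<in> carrier F" "\<beta> \<in> carrier F" "a \<in> carrier B" "b \<in> carrier B" for \<alpha> \<beta> a b
    using that
    by (simp add: g.smult_r_distr g.smult_diff g.smult_diff_scalar g.smult_assoc1
        g.M.diff_simps g.M.a_ac)
qed (auto simp: heap_homs_def ring_heap_def g.smult_r_distr g.smult_l_distr
    g.smult_diff g.smult_diff_scalar g.M.diff_simps g.M.a_ac)

text \<open>In each of its arguments the bracket of \<open>B\<close> is a linear map plus a constant, hence affine.\<close>

lemma translate_linear_affine:
  assumes f: "f \<in> lin_maps F g g" and t: "t \<in> carrier g"
  shows "(\<lambda>x. f x \<oplus>\<^bsub>g\<^esub> t) \<in> affine_maps F B B"
  using t
  by (auto simp: affine_maps_def heap_homs_def g.smult_r_distr g.smult_diff_scalar lin_mapsD[OF f]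
      lin_map_zero_minus[OF g.M.abelian_group_axioms g.M.abelian_group_axioms f])
    (simp_all add: g.M.diff_simps g.M.a_ac lin_mapsD[OF f])

lemma B_bracket_affine_right:
  assumes a: "a \<in> carrier g"
  shows "(\<lambda>b. \<lbrace>a, b\<rbrace>\<^bsub>B\<^esub>) \<in> affine_maps F B B"
proof -
  have "(\<lambda>b. lbr g a b \<oplus>\<^bsub>g\<^esub> \<Lambda> b \<oplus>\<^bsub>g\<^esub> (\<kappa> a \<ominus>\<^bsub>g\<^esub> \<Lambda> a \<oplus>\<^bsub>g\<^esub> s)) \<in> affine_maps F B B"
    using a
    by (intro translate_linear_affine g.lin_maps_sum_diff bracket_linear_right Lambda_linear)
      simp_all
  moreover have "\<lbrace>a, b\<rbrace>\<^bsub>B\<^esub> = lbr g a b \<oplus>\<^bsub>g\<^esub> \<Lambda> b \<oplus>\<^bsub>g\<^esub> (\<kappa> a \<ominus>\<^bsub>g\<^esub> \<Lambda> a \<oplus>\<^bsub>g\<^esub> s)"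
    if "b \<in> carrier g" for b
    using a that by (simp add: B_bracket g.M.diff_simps g.M.a_ac)
  ultimately show ?thesis
    using affine_space.act_closed[OF affine_space_B]
      abelian_heap.tern_closed[OF affine_space.axioms(2)[OF affine_space_B]]
    by (simp add: affine_maps_def heap_homs_def Pi_iff del: B_simps(2,3))
qed

lemma B_bracket_affine_left:
  assumes b: "b \<in> carrier g"
  shows "(\<lambda>a. \<lbrace>a, b\<rbrace>\<^bsub>B\<^esub>) \<in> affine_maps F B B"
proof -
  have "(\<lambda>a. lbr g a b \<oplus>\<^bsub>g\<^esub> \<kappa> a \<ominus>\<^bsub>g\<^esub> \<Lambda> a \<oplus>\<^bsub>g\<^esub> (\<Lambda> b \<oplus>\<^bsub>g\<^esub> s)) \<in> affine_maps F B B"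
    using b
    by (intro translate_linear_affine g.lin_maps_sum_diff bracket_linear_left kappa_linear
        Lambda_linear) simp_all
  moreover have "\<lbrace>a, b\<rbrace>\<^bsub>B\<^esub> = lbr g a b \<oplus>\<^bsub>g\<^esub> \<kappa> a \<ominus>\<^bsub>g\<^esub> \<Lambda> a \<oplus>\<^bsub>g\<^esub> (\<Lambda> b \<oplus>\<^bsub>g\<^esub> s)"
    if "a \<in> carrier g" for a
    using b that by (simp add: B_bracket g.M.diff_simps g.M.a_ac)
  ultimately show ?thesis
    using affine_space.act_closed[OF affine_space_B]
      abelian_heap.tern_closed[OF affine_space.axioms(2)[OF affine_space_B]]
    by (simp add: affine_maps_def heap_homs_def Pi_iff del: B_simps(2,3))
qed

text \<open>The terms in \<open>\<kappa>\<close>, \<open>\<Lambda>\<close> and \<open>s\<close> cancel, so antisymmetry constrains the bilinear part alone.\<close>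

lemma antisym_expansion:
  assumes "a \<in> carrier g" "b \<in> carrier g"
  shows "\<langle>\<lbrace>a, b\<rbrace>\<^bsub>B\<^esub>, \<lbrace>a, a\<rbrace>\<^bsub>B\<^esub>, \<lbrace>b, a\<rbrace>\<^bsub>B\<^esub>\<rangle>\<^bsub>B\<^esub> \<ominus>\<^bsub>g\<^esub> \<lbrace>b, b\<rbrace>\<^bsub>B\<^esub>
    = lbr g a b \<oplus>\<^bsub>g\<^esub> lbr g b a \<ominus>\<^bsub>g\<^esub> lbr g a a \<ominus>\<^bsub>g\<^esub> lbr g b b"
  using assms by (simp add: B_bracket g.M.diff_simps g.M.a_ac)

lemma bracket_anticommutes:
  assumes alt: "\<And>x. x \<in> carrier g \<Longrightarrow> lbr g x x = \<zero>\<^bsub>g\<^esub>"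
    and "a \<in> carrier g" "b \<in> carrier g"
  shows "lbr g b a = \<ominus>\<^bsub>g\<^esub> lbr g a b"
proof -
  have "lbr g (a \<oplus>\<^bsub>g\<^esub> b) (a \<oplus>\<^bsub>g\<^esub> b) = lbr g a b \<oplus>\<^bsub>g\<^esub> lbr g b a"
    using assms(2,3) alt[of a] alt[of b] by (simp add: g.M.a_comm)
  moreover have "lbr g (a \<oplus>\<^bsub>g\<^esub> b) (a \<oplus>\<^bsub>g\<^esub> b) = \<zero>\<^bsub>g\<^esub>"
    using assms(2,3) by (intro alt g.M.add.m_closed)
  ultimately have "lbr g a b \<oplus>\<^bsub>g\<^esub> lbr g b a = \<zero>\<^bsub>g\<^esub>" by simp
  then show ?thesis
    using assms(2,3) by (simp add: g.M.diff_simps g.M.a_ac)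
qed

lemma antisym_iff_alternating:
  "(\<forall>a\<in>carrier g. \<forall>b\<in>carrier g.
      \<langle>\<lbrace>a, b\<rbrace>\<^bsub>B\<^esub>, \<lbrace>a, a\<rbrace>\<^bsub>B\<^esub>, \<lbrace>b, a\<rbrace>\<^bsub>B\<^esub>\<rangle>\<^bsub>B\<^esub> = \<lbrace>b, b\<rbrace>\<^bsub>B\<^esub>)
    \<longleftrightarrow> (\<forall>a\<in>carrier g. lbr g a a = \<zero>\<^bsub>g\<^esub>)"
proof -
  have closed: "\<langle>\<lbrace>a, b\<rbrace>\<^bsub>B\<^esub>, \<lbrace>a, a\<rbrace>\<^bsub>B\<^esub>, \<lbrace>b, a\<rbrace>\<^bsub>B\<^esub>\<rangle>\<^bsub>B\<^esub> \<in> carrier g" "\<lbrace>b, b\<rbrace>\<^bsub>B\<^esub> \<in> carrier g"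
    if "a \<in> carrier g" "b \<in> carrier g" for a b
    using that by (simp_all add: B_bracket)
  have "(\<forall>a\<in>carrier g. \<forall>b\<in>carrier g.
      \<langle>\<lbrace>a, b\<rbrace>\<^bsub>B\<^esub>, \<lbrace>a, a\<rbrace>\<^bsub>B\<^esub>, \<lbrace>b, a\<rbrace>\<^bsub>B\<^esub>\<rangle>\<^bsub>B\<^esub> = \<lbrace>b, b\<rbrace>\<^bsub>B\<^esub>)
    \<longleftrightarrow> (\<forall>a\<in>carrier g. \<forall>b\<in>carrier g.
      lbr g a b \<oplus>\<^bsub>g\<^esub> lbr g b a \<ominus>\<^bsub>g\<^esub> lbr g a a \<ominus>\<^bsub>g\<^esub> lbr g b b = \<zero>\<^bsub>g\<^esub>)"
    by (intro ball_cong refl)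
      (simp only: antisym_expansion[symmetric] g.M.diff_eq_zero_iff[OF closed])
  also have "\<dots> \<longleftrightarrow> (\<forall>a\<in>carrier g. lbr g a a = \<zero>\<^bsub>g\<^esub>)"
  proof (intro iffI ballI)
    fix a
    assume "\<forall>a\<in>carrier g. \<forall>b\<in>carrier g.
      lbr g a b \<oplus>\<^bsub>g\<^esub> lbr g b a \<ominus>\<^bsub>g\<^esub> lbr g a a \<ominus>\<^bsub>g\<^esub> lbr g b b = \<zero>\<^bsub>g\<^esub>" and a: "a \<in> carrier g"
    \<comment> \<open>At \<open>b = 0\<close> every term but \<open>[a, a]\<close> vanishes by bilinearity.\<close>
    then have "lbr g a \<zero>\<^bsub>g\<^esub> \<oplus>\<^bsub>g\<^esub> lbr g \<zero>\<^bsub>g\<^esub> a \<ominus>\<^bsub>g\<^esub> lbr g a a \<ominus>\<^bsub>g\<^esub> lbr g \<zero>\<^bsub>g\<^esub> \<zero>\<^bsub>g\<^esub> = \<zero>\<^bsub>g\<^esub>"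
      by blast
    then show "lbr g a a = \<zero>\<^bsub>g\<^esub>" using a by (simp add: g.M.diff_simps)
  next
    fix a b
    assume "\<forall>a\<in>carrier g. lbr g a a = \<zero>\<^bsub>g\<^esub>" "a \<in> carrier g" "b \<in> carrier g"
    then show "lbr g a b \<oplus>\<^bsub>g\<^esub> lbr g b a \<ominus>\<^bsub>g\<^esub> lbr g a a \<ominus>\<^bsub>g\<^esub> lbr g b b = \<zero>\<^bsub>g\<^esub>"
      by (simp add: bracket_anticommutes[of a b] g.M.diff_simps)
  qed
  finally show ?thesis .
qed

definition compat_defect :: "'a \<Rightarrow> 'a \<Rightarrow> 'a"
  where "compat_defect a b =
    \<Lambda> (lbr g a b) \<ominus>\<^bsub>g\<^esub> (lbr g (\<Lambda> a) b \<ominus>\<^bsub>g\<^esub> lbr g a (\<kappa> b) \<oplus>\<^bsub>g\<^esub> lbr g a (\<Lambda> b))"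

lemma compat_defect_closed [simp]:
  "\<lbrakk>a \<in> carrier g; b \<in> carrier g\<rbrakk> \<Longrightarrow> compat_defect a b \<in> carrier g"
  by (simp add: compat_defect_def)

lemma compat_defect_zero [simp]:
  "a \<in> carrier g \<Longrightarrow> compat_defect a \<zero>\<^bsub>g\<^esub> = \<zero>\<^bsub>g\<^esub>"
  "a \<in> carrier g \<Longrightarrow> compat_defect \<zero>\<^bsub>g\<^esub> a = \<zero>\<^bsub>g\<^esub>"
  by (simp_all add: compat_defect_def g.M.diff_simps)

lemma compatible_pair_iff_defect:
  "compatible_pair g \<kappa> \<Lambda>
    \<longleftrightarrow> (\<forall>a\<in>carrier g. \<forall>b\<in>carrier g. compat_defect a b = \<zero>\<^bsub>g\<^esub>)"
  by (simp add: compatible_pair_def compat_defect_def g.M.diff_eq_zero_iff)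

definition jacobiator :: "'a \<Rightarrow> 'a \<Rightarrow> 'a \<Rightarrow> 'a"
  where "jacobiator a b c =
    lbr g a (lbr g b c) \<oplus>\<^bsub>g\<^esub> lbr g b (lbr g c a) \<oplus>\<^bsub>g\<^esub> lbr g c (lbr g a b)"

lemma jacobiator_closed [simp]:
  "\<lbrakk>a \<in> carrier g; b \<in> carrier g; c \<in> carrier g\<rbrakk> \<Longrightarrow> jacobiator a b c \<in> carrier g"
  by (simp add: jacobiator_def)

lemma jacobiator_zero [simp]:
  "\<lbrakk>a \<in> carrier g; b \<in> carrier g\<rbrakk> \<Longrightarrow> jacobiator a b \<zero>\<^bsub>g\<^esub> = \<zero>\<^bsub>g\<^esub>"
  by (simp add: jacobiator_def)

text \<open>The affine Jacobi identity says that the cyclic sum of these differences is zero.\<close>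

lemma nested_bracket_diff:
  assumes alt: "\<And>x. x \<in> carrier g \<Longrightarrow> lbr g x x = \<zero>\<^bsub>g\<^esub>"
    and "a \<in> carrier g" "b \<in> carrier g" "c \<in> carrier g"
  shows "\<lbrace>a, \<lbrace>b, c\<rbrace>\<^bsub>B\<^esub>\<rbrace>\<^bsub>B\<^esub> \<ominus>\<^bsub>g\<^esub> \<lbrace>a, \<lbrace>a, a\<rbrace>\<^bsub>B\<^esub>\<rbrace>\<^bsub>B\<^esub>
    = lbr g a (lbr g b c) \<oplus>\<^bsub>g\<^esub> lbr g a (\<kappa> b) \<oplus>\<^bsub>g\<^esub> lbr g a (\<Lambda> c) \<ominus>\<^bsub>g\<^esub> lbr g a (\<Lambda> b)
      \<ominus>\<^bsub>g\<^esub> lbr g a (\<kappa> a) \<oplus>\<^bsub>g\<^esub> \<Lambda> (lbr g b c) \<oplus>\<^bsub>g\<^esub> \<Lambda> (\<kappa> b) \<ominus>\<^bsub>g\<^esub> \<Lambda> (\<kappa> a)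
      \<oplus>\<^bsub>g\<^esub> \<Lambda> (\<Lambda> c) \<ominus>\<^bsub>g\<^esub> \<Lambda> (\<Lambda> b)"
  using assms by (simp add: B_bracket g.M.diff_simps g.M.a_ac)

lemma tern5_diff:
  assumes "x1 \<in> carrier g" "y1 \<in> carrier g" "x2 \<in> carrier g" "y2 \<in> carrier g"
    "x3 \<in> carrier g" "y3 \<in> carrier g"
  shows "tern5 B x1 y1 x2 y2 x3 \<ominus>\<^bsub>g\<^esub> y3
    = (x1 \<ominus>\<^bsub>g\<^esub> y1) \<oplus>\<^bsub>g\<^esub> (x2 \<ominus>\<^bsub>g\<^esub> y2) \<oplus>\<^bsub>g\<^esub> (x3 \<ominus>\<^bsub>g\<^esub> y3)"
  using assms by (simp add: tern5_def g.M.diff_simps g.M.a_ac)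

text \<open>Write \<open>C\<close> for \<open>compat_defect\<close>. In the cyclic sum of \<open>nested_bracket_diff\<close> the terms in \<open>\<Lambda> (\<kappa> _)\<close> and \<open>\<Lambda> (\<Lambda> _)\<close> cancel around
  the cycle. The remaining terms with two distinct arguments regroup, after relabelling and
  \<open>[\<Lambda> x, y] = - [y, \<Lambda> x]\<close>, into the three mixed defects. The terms \<open>- [a, \<kappa> a]\<close> are minus the
  diagonal defects, since \<open>C a a = \<Lambda> [a, a] - [\<Lambda> a, a] + [a, \<kappa> a] - [a, \<Lambda> a] = [a, \<kappa> a]\<close>.\<close>

lemma jacobi_expansion:
  assumes alt: "\<And>x. x \<in> carrier g \<Longrightarrow> lbr g x x = \<zero>\<^bsub>g\<^esub>"
    and abc: "a \<in> carrier g" "b \<in> carrier g" "c \<in> carrier g"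
  shows "tern5 B \<lbrace>a, \<lbrace>b, c\<rbrace>\<^bsub>B\<^esub>\<rbrace>\<^bsub>B\<^esub> \<lbrace>a, \<lbrace>a, a\<rbrace>\<^bsub>B\<^esub>\<rbrace>\<^bsub>B\<^esub>
        \<lbrace>b, \<lbrace>c, a\<rbrace>\<^bsub>B\<^esub>\<rbrace>\<^bsub>B\<^esub> \<lbrace>b, \<lbrace>b, b\<rbrace>\<^bsub>B\<^esub>\<rbrace>\<^bsub>B\<^esub> \<lbrace>c, \<lbrace>a, b\<rbrace>\<^bsub>B\<^esub>\<rbrace>\<^bsub>B\<^esub>
      \<ominus>\<^bsub>g\<^esub> \<lbrace>c, \<lbrace>c, c\<rbrace>\<^bsub>B\<^esub>\<rbrace>\<^bsub>B\<^esub>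
    = jacobiator a b c
      \<oplus>\<^bsub>g\<^esub> compat_defect a b \<oplus>\<^bsub>g\<^esub> compat_defect b c \<oplus>\<^bsub>g\<^esub> compat_defect c a
      \<ominus>\<^bsub>g\<^esub> compat_defect a a \<ominus>\<^bsub>g\<^esub> compat_defect b b \<ominus>\<^bsub>g\<^esub> compat_defect c c"
proof -
  note anticomm = bracket_anticommutes[OF alt]
  \<comment> \<open>With every \<open>\<Lambda>\<close> moved to the right argument, cancelling terms become syntactically equal.\<close>
  have flips: "lbr g (\<Lambda> a) b = \<ominus>\<^bsub>g\<^esub> lbr g b (\<Lambda> a)" "lbr g (\<Lambda> b) c = \<ominus>\<^bsub>g\<^esub> lbr g c (\<Lambda> b)"
    "lbr g (\<Lambda> c) a = \<ominus>\<^bsub>g\<^esub> lbr g a (\<Lambda> c)" "lbr g (\<Lambda> a) a = \<ominus>\<^bsub>g\<^esub> lbr g a (\<Lambda> a)"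
    "lbr g (\<Lambda> b) b = \<ominus>\<^bsub>g\<^esub> lbr g b (\<Lambda> b)" "lbr g (\<Lambda> c) c = \<ominus>\<^bsub>g\<^esub> lbr g c (\<Lambda> c)"
    using abc by (simp_all add: anticomm[of _ "\<Lambda> _"])
  show ?thesis
    using abc
    by (simp add: tern5_diff B_bracket_closed nested_bracket_diff[OF alt] jacobiator_def
        compat_defect_def alt flips)
      (simp add: g.M.diff_simps g.M.a_ac)
qed

lemma jacobi_iff:
  assumes alt: "\<And>x. x \<in> carrier g \<Longrightarrow> lbr g x x = \<zero>\<^bsub>g\<^esub>"
  shows "(\<forall>a\<in>carrier g. \<forall>b\<in>carrier g. \<forall>c\<in>carrier g.
      tern5 B \<lbrace>a, \<lbrace>b, c\<rbrace>\<^bsub>B\<^esub>\<rbrace>\<^bsub>B\<^esub> \<lbrace>a, \<lbrace>a, a\<rbrace>\<^bsub>B\<^esub>\<rbrace>\<^bsub>B\<^esub>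
        \<lbrace>b, \<lbrace>c, a\<rbrace>\<^bsub>B\<^esub>\<rbrace>\<^bsub>B\<^esub> \<lbrace>b, \<lbrace>b, b\<rbrace>\<^bsub>B\<^esub>\<rbrace>\<^bsub>B\<^esub> \<lbrace>c, \<lbrace>a, b\<rbrace>\<^bsub>B\<^esub>\<rbrace>\<^bsub>B\<^esub>
      = \<lbrace>c, \<lbrace>c, c\<rbrace>\<^bsub>B\<^esub>\<rbrace>\<^bsub>B\<^esub>)
    \<longleftrightarrow> (\<forall>a\<in>carrier g. \<forall>b\<in>carrier g. \<forall>c\<in>carrier g. jacobiator a b c = \<zero>\<^bsub>g\<^esub>)
        \<and> compatible_pair g \<kappa> \<Lambda>"
    (is "?J \<longleftrightarrow> ?R")
proof -
  let ?S = "\<lambda>a b c. jacobiator a b c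
      \<oplus>\<^bsub>g\<^esub> compat_defect a b \<oplus>\<^bsub>g\<^esub> compat_defect b c \<oplus>\<^bsub>g\<^esub> compat_defect c a
      \<ominus>\<^bsub>g\<^esub> compat_defect a a \<ominus>\<^bsub>g\<^esub> compat_defect b b \<ominus>\<^bsub>g\<^esub> compat_defect c c"
  have "?J \<longleftrightarrow> (\<forall>a\<in>carrier g. \<forall>b\<in>carrier g. \<forall>c\<in>carrier g. ?S a b c = \<zero>\<^bsub>g\<^esub>)"
    by (intro ball_cong refl)
      (simp add: jacobi_expansion[OF alt, symmetric] g.M.diff_eq_zero_iff B_bracket_closed tern5_def)
  also have "\<dots> \<longleftrightarrow> ?R"
  proof
    assume S: "\<forall>a\<in>carrier g. \<forall>b\<in>carrier g. \<forall>c\<in>carrier g. ?S a b c = \<zero>\<^bsub>g\<^esub>"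
    \<comment> \<open>The Jacobiator and the defects vanish at a zero argument: \<open>b = c = 0\<close> isolates the
      diagonal defect at \<open>a\<close>, and then \<open>c = 0\<close> isolates the defect at \<open>a, b\<close>.\<close>
    have diag: "compat_defect a a = \<zero>\<^bsub>g\<^esub>" if "a \<in> carrier g" for a
      using S[rule_format, of a "\<zero>\<^bsub>g\<^esub>" "\<zero>\<^bsub>g\<^esub>"] that by (simp add: g.M.diff_simps)
    have defect: "compat_defect a b = \<zero>\<^bsub>g\<^esub>" if "a \<in> carrier g" "b \<in> carrier g" for a b
      using S[rule_format, of a b "\<zero>\<^bsub>g\<^esub>"] that by (simp add: g.M.diff_simps diag)
    have "jacobiator a b c = \<zero>\<^bsub>g\<^esub>"
      if "a \<in> carrier g" "b \<in> carrier g" "c \<in> carrier g" for a b c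
      using S[rule_format, of a b c] that by (simp add: g.M.diff_simps defect)
    with defect show ?R by (simp add: compatible_pair_iff_defect)
  next
    assume ?R
    then show "\<forall>a\<in>carrier g. \<forall>b\<in>carrier g. \<forall>c\<in>carrier g. ?S a b c = \<zero>\<^bsub>g\<^esub>"
      by (simp add: compatible_pair_iff_defect g.M.diff_simps)
  qed
  finally show ?thesis .
qed

lemma lie_algebra_iff:
  "lie_algebra F g \<longleftrightarrow> (\<forall>a\<in>carrier g. lbr g a a = \<zero>\<^bsub>g\<^esub>)
    \<and> (\<forall>a\<in>carrier g. \<forall>b\<in>carrier g. \<forall>c\<in>carrier g. jacobiator a b c = \<zero>\<^bsub>g\<^esub>)"
  unfolding lie_algebra_def lie_algebra_axioms_def jacobiator_def
  using F.field_axioms g.module_axioms bracket_linear_right bracket_linear_left by blast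

lemma lie_affgebra_iff_identities:
  "lie_affgebra F B \<longleftrightarrow>
    (\<forall>a\<in>carrier g. \<forall>b\<in>carrier g.
      \<langle>\<lbrace>a, b\<rbrace>\<^bsub>B\<^esub>, \<lbrace>a, a\<rbrace>\<^bsub>B\<^esub>, \<lbrace>b, a\<rbrace>\<^bsub>B\<^esub>\<rangle>\<^bsub>B\<^esub> = \<lbrace>b, b\<rbrace>\<^bsub>B\<^esub>)
    \<and> (\<forall>a\<in>carrier g. \<forall>b\<in>carrier g. \<forall>c\<in>carrier g.
      tern5 B \<lbrace>a, \<lbrace>b, c\<rbrace>\<^bsub>B\<^esub>\<rbrace>\<^bsub>B\<^esub> \<lbrace>a, \<lbrace>a, a\<rbrace>\<^bsub>B\<^esub>\<rbrace>\<^bsub>B\<^esub>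
        \<lbrace>b, \<lbrace>c, a\<rbrace>\<^bsub>B\<^esub>\<rbrace>\<^bsub>B\<^esub> \<lbrace>b, \<lbrace>b, b\<rbrace>\<^bsub>B\<^esub>\<rbrace>\<^bsub>B\<^esub> \<lbrace>c, \<lbrace>a, b\<rbrace>\<^bsub>B\<^esub>\<rbrace>\<^bsub>B\<^esub>
      = \<lbrace>c, \<lbrace>c, c\<rbrace>\<^bsub>B\<^esub>\<rbrace>\<^bsub>B\<^esub>)"
  unfolding lie_affgebra_def lie_affgebra_axioms_def B_simps(1)
  using affine_space_B B_bracket_affine_right B_bracket_affine_left by blast

theorem lie_affgebra_iff:
  "lie_affgebra F B \<longleftrightarrow> lie_algebra F g \<and> compatible_pair g \<kappa> \<Lambda>"
  unfolding lie_affgebra_iff_identities antisym_iff_alternating lie_algebra_iff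
  using jacobi_iff by blast

end

section \<open>Tangent Lie algebras\<close>

lemma tangent_lie_simps:
  fixes A :: "('f, 'a, 'n) lie_aff_scheme"
  shows "carrier (tangent_lie A p) = carrier (tangent_space A p)"
    and "\<zero>\<^bsub>tangent_lie A p\<^esub> = \<zero>\<^bsub>tangent_space A p\<^esub>"
    and "add (tangent_lie A p) = add (tangent_space A p)"
    and "smult (tangent_lie A p) = smult (tangent_space A p)"
    and "a_minus (tangent_lie A p) = a_minus (tangent_space A p)"
    and "lbr (tangent_lie A p) a b = \<lbrace>a, b\<rbrace>\<^bsub>A\<^esub> \<ominus>\<^bsub>tangent_space A p\<^esub> \<lbrace>a, p\<rbrace>\<^bsub>A\<^esub>
      \<oplus>\<^bsub>tangent_space A p\<^esub> \<lbrace>p, p\<rbrace>\<^bsub>A\<^esub> \<ominus>\<^bsub>tangent_space A p\<^esub> \<lbrace>p, b\<rbrace>\<^bsub>A\<^esub>"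
    and "lin_maps F (tangent_lie A p) (tangent_lie A p)
      = lin_maps F (tangent_space A p) (tangent_space A p)"
  by (simp_all add: tangent_lie_def Let_def module.defs a_minus_def[abs_def] a_inv_def
      m_inv_def lin_maps_def)

context lie_affgebra
begin

lemma abr_closed [simp]: "\<lbrakk>a \<in> carrier A; b \<in> carrier A\<rbrakk> \<Longrightarrow> \<lbrace>a, b\<rbrace>\<^bsub>A\<^esub> \<in> carrier A"
  using abr_affine_right[of a] by (auto simp: affine_maps_def heap_homs_def)

lemma tangent_lie_module: "p \<in> carrier A \<Longrightarrow> module F (tangent_lie A p)"
proof -
  assume p: "p \<in> carrier A"
  interpret T: module F "tangent_space A p" using p by (rule tangent_module)
  show ?thesis
  proof (intro moduleI abelian_groupI)
    show "\<exists>y\<in>carrier (tangent_lie A p). y \<oplus>\<^bsub>tangent_lie A p\<^esub> x = \<zero>\<^bsub>tangent_lie A p\<^esub>"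
      if "x \<in> carrier (tangent_lie A p)" for x
      using that T.M.l_neg[of x] T.M.a_inv_closed[of x] unfolding tangent_lie_simps by blast
  qed (simp_all add: tangent_lie_simps T.M.a_ac T.smult_l_distr T.smult_r_distr T.smult_assoc1
      F.is_cring)
qed

text \<open>The choice of the two maps is forced. Since \<open>p\<close> is the zero vector, a bracket of the form
  \<open>[a, b] + \<kappa> a + \<Lambda> (b - a) + s\<close> has \<open>{p, b} = \<Lambda> b + s\<close> and \<open>{a, p} = \<kappa> a - \<Lambda> a + s\<close>, whence
  \<open>s = {p, p}\<close>, and \<open>\<Lambda>\<close> and \<open>\<kappa> - \<Lambda>\<close> are the linear parts \<open>R\<close> and \<open>L\<close> of \<open>{p, _}\<close> and \<open>{_, p}\<close>.
  The tangent bracket is bilinear because, in each variable, it is the difference of the linear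
  parts of two affine maps.\<close>

lemma tangent_data:
  assumes p: "p \<in> carrier A"
  defines "T \<equiv> tangent_lie A p"
  defines "R \<equiv> \<lambda>b. \<lbrace>p, b\<rbrace>\<^bsub>A\<^esub> \<ominus>\<^bsub>T\<^esub> \<lbrace>p, p\<rbrace>\<^bsub>A\<^esub>"
    and "L \<equiv> \<lambda>a. \<lbrace>a, p\<rbrace>\<^bsub>A\<^esub> \<ominus>\<^bsub>T\<^esub> \<lbrace>p, p\<rbrace>\<^bsub>A\<^esub>"
  shows "affgebra_data F T (\<lambda>a. L a \<oplus>\<^bsub>T\<^esub> R a) R \<lbrace>p, p\<rbrace>\<^bsub>A\<^esub>"
    and "lie_aff_eq F A (affgebra_of F T (\<lambda>a. L a \<oplus>\<^bsub>T\<^esub> R a) R \<lbrace>p, p\<rbrace>\<^bsub>A\<^esub>)"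
proof -
  interpret T: module F T unfolding T_def using p by (rule tangent_lie_module)
  have carrier: "carrier T = carrier A"
    by (simp add: T_def tangent_lie_simps tangent_simps)
  have closed: "\<lbrace>x, y\<rbrace>\<^bsub>A\<^esub> \<in> carrier T" if "x \<in> carrier T" "y \<in> carrier T" for x y
    using that by (simp add: carrier)
  have pT: "p \<in> carrier T" using p by (simp add: carrier)
  have right: "(\<lambda>b. \<lbrace>a, b\<rbrace>\<^bsub>A\<^esub> \<ominus>\<^bsub>T\<^esub> \<lbrace>a, p\<rbrace>\<^bsub>A\<^esub>) \<in> lin_maps F T T" if "a \<in> carrier T" for a
    using affine_map_linear_part[OF p abr_affine_right] that
    by (simp add: carrier) (simp add: T_def tangent_lie_simps)
  have left: "(\<lambda>a. \<lbrace>a, b\<rbrace>\<^bsub>A\<^esub> \<ominus>\<^bsub>T\<^esub> \<lbrace>p, b\<rbrace>\<^bsub>A\<^esub>) \<in> lin_maps F T T" if "b \<in> carrier T" for b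
    using affine_map_linear_part[OF p abr_affine_left] that
    by (simp add: carrier) (simp add: T_def tangent_lie_simps)
  have bracket: "lbr T a b = \<lbrace>a, b\<rbrace>\<^bsub>A\<^esub> \<ominus>\<^bsub>T\<^esub> \<lbrace>a, p\<rbrace>\<^bsub>A\<^esub> \<oplus>\<^bsub>T\<^esub> \<lbrace>p, p\<rbrace>\<^bsub>A\<^esub> \<ominus>\<^bsub>T\<^esub> \<lbrace>p, b\<rbrace>\<^bsub>A\<^esub>" for a b
    by (simp add: T_def tangent_lie_simps)
  have R: "R \<in> lin_maps F T T" and L: "L \<in> lin_maps F T T"
    unfolding R_def L_def using right[OF pT] left[OF pT] by simp_all
  show data: "affgebra_data F T (\<lambda>a. L a \<oplus>\<^bsub>T\<^esub> R a) R \<lbrace>p, p\<rbrace>\<^bsub>A\<^esub>"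
  proof (intro affgebra_data.intro affgebra_data_axioms.intro)
    show "field F" by (rule F.field_axioms)
    show "module F T" by (rule T.module_axioms)
    show "R \<in> lin_maps F T T" by (rule R)
    show "(\<lambda>a. L a \<oplus>\<^bsub>T\<^esub> R a) \<in> lin_maps F T T"
      using L R by (rule T.lin_maps_sum_diff)
    show "\<lbrace>p, p\<rbrace>\<^bsub>A\<^esub> \<in> carrier T" using closed[OF pT pT] .
    show "lbr T a \<in> lin_maps F T T" if a: "a \<in> carrier T" for a
    proof (rule T.lin_maps_cong)
      show "(\<lambda>b. (\<lbrace>a, b\<rbrace>\<^bsub>A\<^esub> \<ominus>\<^bsub>T\<^esub> \<lbrace>a, p\<rbrace>\<^bsub>A\<^esub>) \<ominus>\<^bsub>T\<^esub> (\<lbrace>p, b\<rbrace>\<^bsub>A\<^esub> \<ominus>\<^bsub>T\<^esub> \<lbrace>p, p\<rbrace>\<^bsub>A\<^esub>)) \<in> lin_maps F T T"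
        using right[OF a] right[OF pT] by (rule T.lin_maps_sum_diff)
    qed (use a pT closed in \<open>simp add: bracket T.M.diff_simps T.M.a_ac\<close>)
    show "(\<lambda>a. lbr T a b) \<in> lin_maps F T T" if b: "b \<in> carrier T" for b
    proof (rule T.lin_maps_cong)
      show "(\<lambda>a. (\<lbrace>a, b\<rbrace>\<^bsub>A\<^esub> \<ominus>\<^bsub>T\<^esub> \<lbrace>p, b\<rbrace>\<^bsub>A\<^esub>) \<ominus>\<^bsub>T\<^esub> (\<lbrace>a, p\<rbrace>\<^bsub>A\<^esub> \<ominus>\<^bsub>T\<^esub> \<lbrace>p, p\<rbrace>\<^bsub>A\<^esub>)) \<in> lin_maps F T T"
        using left[OF b] left[OF pT] by (rule T.lin_maps_sum_diff)
    qed (use b pT closed in \<open>simp add: bracket T.M.diff_simps T.M.a_ac\<close>)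
  qed
  interpret data: affgebra_data F T "\<lambda>a. L a \<oplus>\<^bsub>T\<^esub> R a" R "\<lbrace>p, p\<rbrace>\<^bsub>A\<^esub>" by (rule data)
  have tern: "\<langle>a, b, c\<rangle>\<^bsub>A\<^esub> = a \<ominus>\<^bsub>T\<^esub> b \<oplus>\<^bsub>T\<^esub> c"
    if "a \<in> carrier A" "b \<in> carrier A" "c \<in> carrier A" for a b c
    using tern_tangent[OF p that] by (simp add: T_def tangent_lie_simps)
  have act: "act A \<alpha> a b = \<alpha> \<odot>\<^bsub>T\<^esub> b \<oplus>\<^bsub>T\<^esub> (\<one> \<ominus> \<alpha>) \<odot>\<^bsub>T\<^esub> a"
    if "\<alpha> \<in> carrier F" "a \<in> carrier A" "b \<in> carrier A" for \<alpha> a b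
    using act_tangent[OF p that] by (simp add: T_def tangent_lie_simps)
  have abr: "\<lbrace>a, b\<rbrace>\<^bsub>A\<^esub> = \<lbrace>a, b\<rbrace>\<^bsub>data.B\<^esub>" if "a \<in> carrier T" "b \<in> carrier T" for a b
    using that pT closed
    by (simp add: data.B_bracket) (simp add: bracket L_def R_def T.M.diff_simps T.M.a_ac)
  show "lie_aff_eq F A data.B"
    unfolding lie_aff_eq_def using tern act abr by (simp add: carrier)
qed

end

text \<open>The bracket of \<open>B\<close> is affine in any case, and the two identities mention values of the operations
  on the common carrier only, where those of \<open>A\<close> and \<open>B\<close> agree.\<close>

lemma (in affgebra_data) lie_affgebra_of_eq:
  assumes A: "lie_affgebra F A" and eq: "lie_aff_eq F A B"
  shows "lie_affgebra F B"
proof -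
  interpret A: lie_affgebra F A by (rule A)
  have carrier: "carrier A = carrier g" using eq by (simp add: lie_aff_eq_def)
  have tern: "\<langle>a, b, c\<rangle>\<^bsub>B\<^esub> = \<langle>a, b, c\<rangle>\<^bsub>A\<^esub>"
    if "a \<in> carrier A" "b \<in> carrier A" "c \<in> carrier A" for a b c
    using eq that by (simp add: lie_aff_eq_def)
  have abr: "\<lbrace>a, b\<rbrace>\<^bsub>B\<^esub> = \<lbrace>a, b\<rbrace>\<^bsub>A\<^esub>" if "a \<in> carrier A" "b \<in> carrier A" for a b
    using eq that by (simp add: lie_aff_eq_def)
  show ?thesis
    unfolding lie_affgebra_iff_identities carrier[symmetric]
    using A.abr_antisym A.abr_jacobi
    by (simp add: abr tern tern5_def A.tern_closed del: B_simps)
qed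

corollary (in affgebra_data) lie_algebra_compatible_of_eq:
  assumes "lie_affgebra F A" "lie_aff_eq F A B"
  shows "lie_algebra F g" "compatible_pair g \<kappa> \<Lambda>"
  using lie_affgebra_of_eq[OF assms] lie_affgebra_iff by blast+

theorem (in lie_affgebra) tangent_lie_algebra:
  "p \<in> carrier A \<Longrightarrow> lie_algebra F (tangent_lie A p)"
  using affgebra_data.lie_algebra_compatible_of_eq(1)[OF tangent_data(1) lie_affgebra_axioms
    tangent_data(2)] .

lemma (in lie_algebra) affgebra_dataI:
  assumes "\<kappa> \<in> lin_maps F g g" "\<Lambda> \<in> lin_maps F g g" "s \<in> carrier g"
  shows "affgebra_data F g \<kappa> \<Lambda> s"
  using assms lbr_linear_right lbr_linear_left F.field_axioms g.module_axioms
  by (simp add: affgebra_data_def affgebra_data_axioms_def)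

text \<open>The alternating sum defining the tangent bracket at \<open>p\<close> keeps only the bilinear part, so it is
  \<open>[x - p, y - p] + p\<close> in terms of \<open>g\<close>; the summand \<open>p\<close> is the zero vector of the tangent space.
  Translation by \<open>- p\<close> moves that zero to the zero of \<open>g\<close>.\<close>

lemma (in affgebra_data) tangent_iso:
  assumes B: "lie_affgebra F B" and p: "p \<in> carrier g"
  shows "lie_algebra_isomorphic F (tangent_lie B p) g"
proof -
  interpret B: lie_affgebra F B by (rule B)
  let ?T = "tangent_lie B p" and ?f = "\<lambda>x. x \<ominus>\<^bsub>g\<^esub> p"
  have T_carrier: "carrier ?T = carrier g"
    by (simp add: tangent_lie_simps B.tangent_simps)
  have T_diff: "x \<ominus>\<^bsub>tangent_space B p\<^esub> y = x \<ominus>\<^bsub>g\<^esub> y \<oplus>\<^bsub>g\<^esub> p"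
    if "x \<in> carrier g" "y \<in> carrier g" for x y
    using that p by (simp add: B.tangent_diff)
  have T_bracket: "lbr ?T x y = lbr g (?f x) (?f y) \<oplus>\<^bsub>g\<^esub> p"
    if "x \<in> carrier g" "y \<in> carrier g" for x y
  proof -
    have "lbr ?T x y = \<lbrace>x, y\<rbrace>\<^bsub>B\<^esub> \<ominus>\<^bsub>g\<^esub> \<lbrace>x, p\<rbrace>\<^bsub>B\<^esub> \<oplus>\<^bsub>g\<^esub> \<lbrace>p, p\<rbrace>\<^bsub>B\<^esub> \<ominus>\<^bsub>g\<^esub> \<lbrace>p, y\<rbrace>\<^bsub>B\<^esub> \<oplus>\<^bsub>g\<^esub> p"
      using that p by (simp add: tangent_lie_simps T_diff B.tangent_simps B_bracket_closed)
        (simp add: g.M.diff_simps g.M.a_ac B_bracket_closed)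
    also have "\<dots> = lbr g (?f x) (?f y) \<oplus>\<^bsub>g\<^esub> p"
      using that p by (simp add: B_bracket) (simp add: g.M.diff_simps g.M.a_ac)
    finally show ?thesis .
  qed
  have "?f \<in> lin_maps F ?T g"
    unfolding lin_maps_def
    using p
    by (auto simp: T_carrier)
      (simp_all add: tangent_lie_simps B.tangent_simps g.smult_diff g.smult_diff_scalar
        g.M.diff_simps g.M.a_ac)
  moreover have "bij_betw ?f (carrier ?T) (carrier g)"
    unfolding T_carrier
    by (rule bij_betw_byWitness[where f' = "\<lambda>x. x \<oplus>\<^bsub>g\<^esub> p"])
      (use p in \<open>auto simp: g.M.diff_simps g.M.a_ac\<close>)
  moreover have "?f (lbr ?T x y) = lbr g (?f x) (?f y)"
    if "x \<in> carrier g" "y \<in> carrier g" for x y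
    using that p by (simp add: T_bracket del: bracket_right bracket_left)
      (simp add: g.M.diff_simps g.M.a_ac)
  ultimately have "?f \<in> lie_algebra_isos F ?T g"
    by (simp add: lie_algebra_isos_def T_carrier)
  then show ?thesis
    using B.tangent_lie_algebra[of p] B lie_affgebra_iff p
    by (auto simp: lie_algebra_isomorphic_def)
qed

theorem theorem3p1:
  fixes F :: "('f, 'm) ring_scheme"
    and g :: "('f, 'a, 'n) lie_alg_scheme"
    and A :: "('f, 'b, 'k) lie_aff_scheme"
  assumes "field F"
    and "\<one>\<^bsub>F\<^esub> \<oplus>\<^bsub>F\<^esub> \<one>\<^bsub>F\<^esub> \<noteq> \<zero>\<^bsub>F\<^esub>"
  shows "(lie_algebra F g \<longrightarrow>
           (\<forall>\<kappa>\<in>lin_maps F g g. \<forall>\<Lambda>\<in>lin_maps F g g. compatible_pair g \<kappa> \<Lambda> \<longrightarrow>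
             (\<forall>s\<in>carrier g. lie_affgebra F (affgebra_of F g \<kappa> \<Lambda> s) \<and>
               (\<forall>p\<in>carrier g.
                 lie_algebra_isomorphic F (tangent_lie (affgebra_of F g \<kappa> \<Lambda> s) p) g)))) \<and>
         (lie_affgebra F A \<longrightarrow>
           (\<forall>p\<in>carrier A. let T = tangent_lie A p in
             lie_algebra F T \<and>
             (\<exists>\<kappa>\<in>lin_maps F T T. \<exists>\<Lambda>\<in>lin_maps F T T. \<exists>s\<in>carrier T.
               compatible_pair T \<kappa> \<Lambda> \<and> lie_aff_eq F A (affgebra_of F T \<kappa> \<Lambda> s)) \<and>
             (\<forall>\<kappa>\<in>lin_maps F T T. \<forall>\<Lambda>\<in>lin_maps F T T. \<forall>s\<in>carrier T.
               lie_aff_eq F A (affgebra_of F T \<kappa> \<Lambda> s) \<longrightarrow> compatible_pair T \<kappa> \<Lambda>)))"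
proof (intro conjI impI ballI)
  fix \<kappa> \<Lambda> s
  assume g: "lie_algebra F g" and "\<kappa> \<in> lin_maps F g g" "\<Lambda> \<in> lin_maps F g g" "s \<in> carrier g"
    and compat: "compatible_pair g \<kappa> \<Lambda>"
  then interpret affgebra_data F g \<kappa> \<Lambda> s by (intro lie_algebra.affgebra_dataI)
  show B: "lie_affgebra F (affgebra_of F g \<kappa> \<Lambda> s)"
    using g compat by (simp add: lie_affgebra_iff)
  show "lie_algebra_isomorphic F (tangent_lie (affgebra_of F g \<kappa> \<Lambda> s) p) g"
    if "p \<in> carrier g" for p
    using B that by (rule tangent_iso)
next
  fix p
  assume A: "lie_affgebra F A" and p: "p \<in> carrier A"
  interpret lie_affgebra F A by (rule A)
  define T where "T = tangent_lie A p"
  have T: "lie_algebra F T"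
    unfolding T_def using p by (rule tangent_lie_algebra)
  obtain \<kappa> \<Lambda> s where data: "affgebra_data F T \<kappa> \<Lambda> s"
    and eq: "lie_aff_eq F A (affgebra_of F T \<kappa> \<Lambda> s)"
    unfolding T_def using tangent_data[OF p] by blast
  have "\<exists>\<kappa>\<in>lin_maps F T T. \<exists>\<Lambda>\<in>lin_maps F T T. \<exists>s\<in>carrier T.
      compatible_pair T \<kappa> \<Lambda> \<and> lie_aff_eq F A (affgebra_of F T \<kappa> \<Lambda> s)"
    using affgebra_data.lie_algebra_compatible_of_eq(2)[OF data A eq] eq
      affgebra_data.kappa_linear[OF data] affgebra_data.Lambda_linear[OF data]
      affgebra_data.s_closed[OF data] by blast
  moreover have "compatible_pair T \<kappa>' \<Lambda>'"
    if "\<kappa>' \<in> lin_maps F T T" "\<Lambda>' \<in> lin_maps F T T" "s' \<in> carrier T"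
      "lie_aff_eq F A (affgebra_of F T \<kappa>' \<Lambda>' s')" for \<kappa>' \<Lambda>' s'
    using affgebra_data.lie_algebra_compatible_of_eq(2)[OF
        lie_algebra.affgebra_dataI[OF T that(1-3)] A that(4)] .
  ultimately show "let T = tangent_lie A p in
      lie_algebra F T \<and>
      (\<exists>\<kappa>\<in>lin_maps F T T. \<exists>\<Lambda>\<in>lin_maps F T T. \<exists>s\<in>carrier T.
        compatible_pair T \<kappa> \<Lambda> \<and> lie_aff_eq F A (affgebra_of F T \<kappa> \<Lambda> s)) \<and>
      (\<forall>\<kappa>\<in>lin_maps F T T. \<forall>\<Lambda>\<in>lin_maps F T T. \<forall>s\<in>carrier T.
        lie_aff_eq F A (affgebra_of F T \<kappa> \<Lambda> s) \<longrightarrow> compatible_pair T \<kappa> \<Lambda>)"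
    using T unfolding Let_def T_def[symmetric] by blast
qed

end
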